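(* Let $m,n,k$ be positive integers with $k\le\min\{m,n\}$, $A=[a_{i,j}]\in\mathbb{R}^{m\times n}$, $W=[w_{i,j}]\in\mathbb{R}^{m\times n}$ with $w_{i,j}\ge0$ and $\sum_{i,j}w_{i,j}=1$, and $\lambda>0$. Let $\overline\alpha>0$, $\beta,\iota\in(0,1)$ and $(U_0,\mathbf x_0,V_0)\in\mathcal M=V_k(\mathbb{R}^m)\times\mathbb{R}^k\times V_k(\mathbb{R}^n)$. Let $\{(U_t,\mathbf x_t,V_t)\}_{t=0}^\infty\subset\mathcal M$ be any sequence starting at $(U_0,\mathbf x_0,V_0)$ such that for all $t\ge0$ $$G(U_t,\mathbf x_t,V_t)-G(U_{t+1},\mathbf x_{t+1},V_{t+1})\ \ge\ G(U_t,\mathbf x_t,V_t)-G\big(R_{(U_t,\mathbf x_t,V_t)}(-\tau_t^A\nabla G(U_t,\mathbf x_t,V_t))\big),$$ where $\tau_t^A$ is the Armijo step size of $G$ at $(U_t,\mathbf x_t,V_t)$ for the tangent vector $-\nabla G(U_t,\mathbf x_t,V_t)$ and the scalars $\overline\alpha,\beta,\iota$. Then $\lim_{t\to\infty}\|\nabla G(U_t,\mathbf x_t,V_t)\|=0$ and $\{(U_t,\mathbf x_t,V_t)\}_{t=0}^\infty$ has a subsequence converging to a critical point of $G$.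
   Context: $V_k(\mathbb{R}^n)=\{V\in\mathbb{R}^{n\times k}:V^TV=I_k\}$ is the Stiefel manifold, a Riemannian submanifold of $\mathbb{R}^{n\times k}$ (Frobenius inner product), with $T_XV_k(\mathbb{R}^n)=\{Z\in\mathbb{R}^{n\times k}:X^TZ+Z^TX=0\}$. $\mathcal M$ carries the Riemannian metric induced from $\mathbb{R}^{m\times k}\times\mathbb{R}^k\times\mathbb{R}^{n\times k}$; $\nabla$ denotes the Riemannian gradient. For $\mathbf x=[x_1,\dots,x_k]^T\in\mathbb{R}^k$, $D^{k\times k}_k(\mathbf x)$ is the $k\times k$ diagonal matrix with diagonal entries $x_1,\dots,x_k$. For $(U,\mathbf x,V)\in\mathcal M$ write $[p_{i,j}]=UD^{k\times k}_k(\mathbf x)V^T$ and $$G(U,\mathbf x,V)=\sum_{i=1}^m\sum_{j=1}^n w_{i,j}(a_{i,j}-p_{i,j})^2+\lambda\|\mathbf x\|^2.$$ For a matrix $C$ with linearly independent columns, $\mathrm{qf}(C)$ is the factor $Q$ in the decomposition $C=QT$ with $Q$ having orthonormal columns and $T$ square upper triangular with positive diagonal entries. The retraction $R$ on $\mathcal M$ is $R_{(U,\mathbf x,V)}(Y,\hat{\mathbf x},Z)=(\mathrm{qf}(U+Y),\mathbf x+\hat{\mathbf x},\mathrm{qf}(V+Z))$ for $(Y,\hat{\mathbf x},Z)\in T_UV_k(\mathbb{R}^m)\times\mathbb{R}^k\times T_VV_k(\mathbb{R}^n)$. Armijo step size: for a differentiable function $f$ on a Riemannian manifold with retraction $R$,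 a point $x$, a tangent vector $\xi\in T_xM$, $\overline\alpha>0$ and $\beta,\iota\in(0,1)$, it is $\tau^A=\beta^N\overline\alpha$, where $N$ is the smallest non-negative integer with $f(x)-f(R_x(\beta^N\overline\alpha\xi))\ge-\iota\langle\nabla f(x),\beta^N\overline\alpha\xi\rangle_x$. *)

theory Defs
  imports "HOL-Analysis.Analysis"
begin

text \<open>An \<open>m \<times> k\<close> real matrix has type \<open>real^'k^'m\<close>; the library inner product and norm on
  this type are the Frobenius ones, and those on product types are the sums over the components.\<close>

type_synonym ('m, 'k, 'n) triple =
  "((real, 'k) vec, 'm) vec \<times> (real, 'k) vec \<times> ((real, 'k) vec, 'n) vec"

definition stiefel :: "(real^'k^'n) set" where
  "stiefel = {V. transpose V ** V = mat 1}"

definition stiefel_tangent :: "real^'k^'n \<Rightarrow> (real^'k^'n) set" where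
  "stiefel_tangent X = {Z. transpose X ** Z + transpose Z ** X = 0}"

definition svd_manifold :: "('m::finite, 'k::finite, 'n::finite) triple set" where
  "svd_manifold = stiefel \<times> UNIV \<times> stiefel"

definition svd_tangent ::
  "('m::finite, 'k::finite, 'n::finite) triple \<Rightarrow> ('m, 'k, 'n) triple set" where
  "svd_tangent = (\<lambda>(U, x, V). stiefel_tangent U \<times> UNIV \<times> stiefel_tangent V)"

text \<open>Riemannian gradient on a submanifold of Euclidean space with the induced metric, where
  \<open>T p\<close> is the tangent space at \<open>p\<close>: the tangent vector representing the differential of \<open>f\<close>
  on \<open>T p\<close>. The function \<open>f\<close> is given on the ambient space (and differentiable there), so the
  differential of its restriction to the submanifold is the restriction to \<open>T p\<close> of the
  ambient derivative.\<close>

definition riemannian_gradient ::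
  "('a \<Rightarrow> 'a set) \<Rightarrow> ('a::euclidean_space \<Rightarrow> real) \<Rightarrow> 'a \<Rightarrow> 'a" where
  "riemannian_gradient T f p =
     (THE g. g \<in> T p \<and> (\<forall>\<xi>\<in>T p. g \<bullet> \<xi> = frechet_derivative f (at p) \<xi>))"

definition critical_point ::
  "'a set \<Rightarrow> ('a \<Rightarrow> 'a set) \<Rightarrow> ('a::euclidean_space \<Rightarrow> real) \<Rightarrow> 'a \<Rightarrow> bool" where
  "critical_point M T f p \<longleftrightarrow> p \<in> M \<and> riemannian_gradient T f p = 0"

definition diag_matrix :: "real^'k \<Rightarrow> real^'k^'k" where
  "diag_matrix x = (\<chi> i j. if i = j then x $ i else 0)"

definition objective ::
  "real^'n^'m \<Rightarrow> real^'n^'m \<Rightarrow> real \<Rightarrow> ('m, 'k::finite, 'n) triple \<Rightarrow> real" where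
  "objective W A lam = (\<lambda>(U, x, V).
     let P = U ** diag_matrix x ** transpose V
     in (\<Sum>i\<in>UNIV. \<Sum>j\<in>UNIV. W $ i $ j * (A $ i $ j - P $ i $ j)^2) + lam * (norm x)^2)"

text \<open>The linear order on the column index type only serves to make sense of
  ``upper triangular''. The value is meaningful for linearly independent columns.\<close>

definition qf :: "((real, 'k::{finite,linorder}) vec, 'n::finite) vec \<Rightarrow> ((real, 'k) vec, 'n) vec" where
  "qf C = (THE Q. transpose Q ** Q = mat 1 \<and>
     (\<exists>T :: ((real, 'k) vec, 'k) vec.
        C = Q ** T \<and> (\<forall>i j. j < i \<longrightarrow> T $ i $ j = 0) \<and> (\<forall>i. T $ i $ i > 0)))"

definition qf_retraction ::
  "('m::finite, 'k::{finite,linorder}, 'n::finite) triple \<Rightarrow> ('m, 'k, 'n) triple \<Rightarrow> ('m, 'k, 'n) triple" where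
  "qf_retraction = (\<lambda>(U, x, V) (Y, y, Z). (qf (U + Y), x + y, qf (V + Z)))"

definition armijo_step ::
  "('a \<Rightarrow> 'a set) \<Rightarrow> ('a \<Rightarrow> 'a \<Rightarrow> 'a) \<Rightarrow> ('a::euclidean_space \<Rightarrow> real) \<Rightarrow> 'a \<Rightarrow> 'a \<Rightarrow>
   real \<Rightarrow> real \<Rightarrow> real \<Rightarrow> real" where
  "armijo_step T R f x \<xi> \<alpha> \<beta> \<iota> =
     \<beta> ^ (LEAST N. f x - f (R x ((\<beta> ^ N * \<alpha>) *\<^sub>R \<xi>))
                    \<ge> - \<iota> * (riemannian_gradient T f x \<bullet> ((\<beta> ^ N * \<alpha>) *\<^sub>R \<xi>))) * \<alpha>"

end

theory Submission
  imports Defs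
begin

text \<open>For \<open>U\<close> on the Stiefel manifold and a tangent \<open>Y\<close>, the Gram matrix of \<open>U + Y\<close> is
  \<open>I + Y\<^sup>T Y\<close>. Hence its triangular factor is \<open>I + O(|Y|\<^sup>2)\<close>, and the retraction satisfies
  \<open>R p \<xi> = p + \<xi> + O(|\<xi>|\<^sup>2)\<close> uniformly on the manifold. If \<open>|grad G|\<close> stayed away from zero along
  a subsequence, the summability of the decreases would force the step sizes to zero there, so the
  Armijo test would fail at steps tending to zero while the iterates accumulate; the
  second-order estimate and the continuity of the ambient gradient then make \<open>grad G\<close> tend to
  zero. Boundedness of the iterates comes from the term \<open>\<lambda>|x|\<^sup>2\<close>.\<close>

section \<open>QR factorization\<close>

definition pos_upper :: "((real, 'k::{finite,linorder}) vec, 'k) vec \<Rightarrow> bool" where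
  "pos_upper T \<longleftrightarrow> (\<forall>i j. j < i \<longrightarrow> T $ i $ j = 0) \<and> (\<forall>i. T $ i $ i > 0)"

section \<open>Gram matrices and orthonormal columns\<close>

lemma gram_entry: "(transpose A ** B) $ i $ j = column i A \<bullet> column j (B :: real^'k^'n)"
  by (simp add: matrix_matrix_mult_def transpose_def column_def inner_vec_def)

lemma gram_entry_sum: "(transpose A ** B) $ i $ j = (\<Sum>l\<in>UNIV. A $ l $ i * (B :: real^'k^'n) $ l $ j)"
  by (simp add: matrix_matrix_mult_def transpose_def)

lemma stiefel_columns:
  "Q \<in> stiefel \<longleftrightarrow> (\<forall>i j. column i Q \<bullet> column j (Q :: real^'k^'n) = (if i = j then 1 else 0))"
  by (simp add: stiefel_def vec_eq_iff gram_entry mat_def)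

text \<open>Passing to quadratic forms of Gram matrices is what makes the Stiefel and tangency
  equations applicable to inner products of images.\<close>

lemma gram_quadratic:
  fixes A B :: "real^'k^'n"
  shows "(A *v v) \<bullet> (B *v v) = ((transpose B ** A) *v v) \<bullet> v"
proof -
  have "(A *v v) \<bullet> (B *v v) = ((A *v v) v* B) \<bullet> v"
    by (simp only: dot_lmul_matrix)
  then show ?thesis
    by (simp only: transpose_matrix_vector[symmetric] matrix_vector_mul_assoc)
qed

lemma stiefel_norm_mult:
  assumes "Q \<in> stiefel" shows "norm (Q *v v) = norm (v :: real^'k)"
  using assms gram_quadratic[of Q v Q] by (simp add: stiefel_def norm_eq)

section \<open>Upper triangular matrices with positive diagonal\<close>

lemma upper_triangular_mult_last:
  fixes T :: "((real, 'k::{finite,linorder}) vec, 'k) vec"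
  assumes "pos_upper T" "v \<noteq> 0"
  obtains j where "v $ j \<noteq> 0" "(T *v v) $ j = T $ j $ j * v $ j"
proof -
  let ?S = "{j. v $ j \<noteq> 0}"
  have ne: "?S \<noteq> {}" using assms(2) by (auto simp: vec_eq_iff)
  define j where "j = Max ?S"
  have j: "v $ j \<noteq> 0" using Max_in[of ?S] ne unfolding j_def by auto
  \<comment> \<open>As \<open>j\<close> is the largest index in the support of \<open>v\<close>, the
    entries of \<open>v\<close> after \<open>j\<close> vanish; those of row \<open>j\<close> of
    \<open>T\<close> before \<open>j\<close> vanish by triangularity. Only the diagonal term is
    left.\<close>
  have last: "v $ l = 0" if "j < l" for l
    using Max_ge[of ?S l] that unfolding j_def by (metis (mono_tags, lifting) finite leD mem_Collect_eq)
  have "(T *v v) $ j = (\<Sum>l\<in>UNIV. T $ j $ l * v $ l)" by (simp add: matrix_vector_mult_def)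
  also have "\<dots> = (\<Sum>l\<in>UNIV. if l = j then T $ j $ j * v $ j else 0)"
  proof (rule sum.cong)
    fix l :: 'k
    show "T $ j $ l * v $ l = (if l = j then T $ j $ j * v $ j else 0)"
      using assms(1) last[of l] by (cases l j rule: linorder_cases) (auto simp: pos_upper_def)
  qed simp
  finally show ?thesis using that j by simp
qed

lemma pos_upper_inj:
  assumes "pos_upper T" shows "inj ((*v) T)"
proof -
  have "v = 0" if "T *v v = 0" for v
  proof (rule ccontr)
    assume "v \<noteq> 0"
    then obtain j where "v $ j \<noteq> 0" "(T *v v) $ j = T $ j $ j * v $ j"
      using upper_triangular_mult_last[OF assms] by metis
    then show False using that assms by (simp add: pos_upper_def) (metis less_irrefl)
  qed
  then show ?thesis by (auto simp: linear_injective_0)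
qed

lemma pos_upper_surj:
  assumes "pos_upper T" obtains v where "T *v v = w"
proof -
  have "surj ((*v) T)"
    by (rule linear_injective_imp_surjective[OF matrix_vector_mul_linear pos_upper_inj[OF assms]]) (rule refl)
  then show ?thesis using that by (metis surjD)
qed

text \<open>The preimage of \<open>axis i (T $ i $ i)\<close> has norm at least 1, so expansion
  bounds the diagonal entry below. For the triangular factor of \<open>U + Y\<close>, expansion will
  come from tangency.\<close>

lemma pos_upper_diag_ge_1:
  assumes T: "pos_upper T" and expand: "\<And>v. norm v \<le> norm (T *v v)"
  shows "1 \<le> T $ i $ i"
proof -
  have pos: "T $ i $ i > 0" using T by (simp add: pos_upper_def)
  \<comment> \<open>Triangularity makes \<open>i\<close> the last index in the support of \<open>v\<close>, and \<open>v $ i = 1\<close>.\<close>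
  obtain v where v: "T *v v = axis i (T $ i $ i)" using pos_upper_surj[OF T] .
  have "v \<noteq> 0"
  proof
    assume "v = 0"
    then have "axis i (T $ i $ i) $ i = 0" using v by (metis matrix_vector_mult_0_right zero_index)
    then show False using pos by (simp add: axis_def)
  qed
  then obtain j where j: "v $ j \<noteq> 0" "(T *v v) $ j = T $ j $ j * v $ j"
    using upper_triangular_mult_last[OF T] by metis
  have "T $ j $ j > 0" using T by (simp add: pos_upper_def)
  then have "axis i (T $ i $ i) $ j \<noteq> 0" using j v by simp
  then have "j = i" by (simp add: axis_def split: if_splits)
  then have "T $ i $ i * v $ i = T $ i $ i * 1" using j v by (simp add: axis_def)
  then have "v $ i = 1" using pos by (metis less_irrefl mult_left_cancel)
  then have "1 \<le> norm v" using component_le_norm_cart[of v i] by simp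
  also have "\<dots> \<le> T $ i $ i" using expand[of v] v pos by (simp add: norm_eq_sqrt_inner inner_axis_axis)
  finally show ?thesis .
qed

text \<open>Rows below \<open>i\<close> drop out because their entries in column \<open>i\<close>
  vanish. This is the Cholesky recursion: the Gram matrix and the rows above determine row
  \<open>i\<close>.\<close>

lemma upper_gram_entry:
  assumes "pos_upper T"
  shows "(transpose T ** T) $ i $ j = T $ i $ i * T $ i $ j + (\<Sum>l\<in>{l. l < i}. T $ l $ i * T $ l $ j)"
proof -
  have "(transpose T ** T) $ i $ j = (\<Sum>l\<in>insert i {l. l < i}. T $ l $ i * T $ l $ j)"
    unfolding gram_entry_sum using assms
    by (intro sum.mono_neutral_right) (auto simp: pos_upper_def not_less le_less)
  then show ?thesis by simp
qed

text \<open>At the first row where the factors differ, the contributions of earlier rows to the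
  Cholesky recursion agree. The case \<open>j = i\<close> and positivity then fix the diagonal
  entry, and with it the whole row.\<close>

lemma pos_upper_gram_unique:
  assumes S: "pos_upper S" and T: "pos_upper T" and eq: "transpose S ** S = transpose T ** T"
  shows "S = T"
proof (rule ccontr)
  let ?D = "{i. S $ i \<noteq> T $ i}"
  assume "S \<noteq> T"
  then have ne: "?D \<noteq> {}" by (auto simp: vec_eq_iff)
  define i where "i = Min ?D"
  have i: "S $ i \<noteq> T $ i" using Min_in[of ?D] ne unfolding i_def by auto
  have before: "S $ l = T $ l" if "l < i" for l
    using Min_le[of ?D l] that unfolding i_def by (metis (mono_tags, lifting) finite leD mem_Collect_eq)
  have row: "S $ i $ i * S $ i $ j = T $ i $ i * T $ i $ j" for j
    using upper_gram_entry[OF S, of i j] upper_gram_entry[OF T, of i j] eq before by simp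
  have pos: "S $ i $ i > 0" "T $ i $ i > 0" using S T by (auto simp: pos_upper_def)
  have "S $ i $ i = T $ i $ i"
    using row[of i] pos by (metis less_imp_le power2_eq_square power2_eq_imp_eq)
  then have "S $ i $ j = T $ i $ j" for j using row[of j] pos by simp
  then show False using i by (simp add: vec_eq_iff)
qed

text \<open>Orthonormal columns cancel in the Gram matrix of the common product, so the triangular
  factors agree by Cholesky uniqueness; being surjective, the common factor can be cancelled on the
  right.\<close>

lemma QR_unique:
  fixes Q Q' :: "((real, 'k::{finite,linorder}) vec, 'n::finite) vec"
  assumes "Q \<in> stiefel" "Q' \<in> stiefel" "pos_upper T" "pos_upper T'" "Q ** T = Q' ** T'"
  shows "Q = Q'"
proof -
  have gram: "transpose (P ** S) ** (P ** S) = transpose S ** S"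
    if "P \<in> stiefel" for P :: "((real, 'k) vec, 'n) vec" and S :: "((real, 'k) vec, 'k) vec"
  proof -
    have "transpose (P ** S) ** (P ** S) = transpose S ** (transpose P ** P) ** S"
      by (simp add: matrix_transpose_mul matrix_mul_assoc)
    then show ?thesis using that by (simp add: stiefel_def)
  qed
  have "T = T'" using pos_upper_gram_unique gram[of Q T] gram[of Q' T'] assms by metis
  have "Q *v w = Q' *v w" for w
    using pos_upper_surj[OF assms(3), of w] assms(5) \<open>T = T'\<close> by (metis matrix_vector_mul_assoc)
  then show ?thesis by (simp add: matrix_eq)
qed

section \<open>Gram-Schmidt orthonormalization\<close>

lemma orthonormal_span_expand:
  fixes q :: "'k::finite \<Rightarrow> 'a::euclidean_space"
  assumes "\<And>i j. q i \<bullet> q j = (if i = j then 1 else 0)" and "c \<in> span (range q)"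
  shows "c = (\<Sum>i\<in>UNIV. (q i \<bullet> c) *\<^sub>R q i)"
  using assms(2)
proof (induction rule: span_induct_alt)
  case base then show ?case by simp
next
  case (step a x y)
  then obtain j where "x = q j" by auto
  have "(\<Sum>i\<in>UNIV. (q i \<bullet> (a *\<^sub>R x + y)) *\<^sub>R q i) =
      a *\<^sub>R (\<Sum>i\<in>UNIV. (q i \<bullet> x) *\<^sub>R q i) + (\<Sum>i\<in>UNIV. (q i \<bullet> y) *\<^sub>R q i)"
    by (simp add: inner_add_right scaleR_add_left sum.distrib scaleR_sum_right)
  also have "(\<Sum>i\<in>UNIV. (q i \<bullet> x) *\<^sub>R q i) = (\<Sum>i\<in>UNIV. if i = j then q i else 0)"
    unfolding \<open>x = q j\<close> assms(1) by (intro sum.cong) auto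
  finally show ?case using step \<open>x = q j\<close> by simp
qed

text \<open>Gram-Schmidt without recursion: \<open>z j\<close> is the part of column
  \<open>j\<close> orthogonal to the span of all preceding columns of \<open>C\<close>, and
  normalizing it gives column \<open>j\<close> of \<open>Q\<close>.\<close>

lemma QR_exists:
  fixes C :: "((real, 'k::{finite,linorder}) vec, 'n::finite) vec"
  assumes inj: "inj ((*v) C)"
  obtains Q T where "Q \<in> stiefel" "pos_upper T" "C = Q ** T"
proof -
  let ?c = "\<lambda>j. column j C"
  let ?W = "\<lambda>j. span (?c ` {l. l < j})"
  have "\<exists>y z. y \<in> ?W j \<and> (\<forall>w\<in>?W j. z \<bullet> w = 0) \<and> ?c j = y + z" for j
    using orthogonal_subspace_decomp_exists[of "?c ` {l. l < j}" "?c j"]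
    unfolding orthogonal_def by metis
  then obtain y z where y: "\<And>j. y j \<in> ?W j" and z: "\<And>j w. w \<in> ?W j \<Longrightarrow> z j \<bullet> w = 0"
    and yz: "\<And>j. ?c j = y j + z j" by metis
  \<comment> \<open>If \<open>z j\<close> vanished, column \<open>j\<close> would be the image of a
    vector supported on indices below \<open>j\<close>; by injectivity that vector would be
    \<open>axis j 1\<close>.\<close>
  have z0: "z j \<noteq> 0" for j
  proof
    assume "z j = 0"
    then have mem: "?c j \<in> ?W j" using y yz[of j] by simp
    have img: "?c ` {l. l < j} = (*v) C ` ((\<lambda>l. axis l 1) ` {l. l < j})"
      by (auto simp: image_image matrix_vector_mult_basis)
    have "?c j \<in> (*v) C ` span ((\<lambda>l. axis l 1) ` {l. l < j})"
      using mem unfolding img by (metis linear_span_image matrix_vector_mul_linear)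
    then obtain v where v: "v \<in> span ((\<lambda>l. axis l 1) ` {l. l < j})" "?c j = C *v v" by auto
    then have "v = axis j 1" using inj by (metis injD matrix_vector_mult_basis)
    moreover have "v $ j = 0"
      using v(1) by (induction rule: span_induct_alt) (auto simp: axis_def split: if_splits)
    ultimately show False by simp
  qed
  define q where "q j = z j /\<^sub>R norm (z j)" for j
  have q1: "q j \<bullet> q j = 1" for j
    using z0[of j] by (simp add: q_def power2_norm_eq_inner[symmetric] power2_eq_square)
  have qW: "q j \<bullet> w = 0" if "w \<in> ?W j" for j w using z[OF that] by (simp add: q_def)
  have qc: "q l \<in> ?W j" if "l < j" for l j
  proof -
    have "?W l \<subseteq> ?W j" using that by (intro span_mono) auto
    then have "y l \<in> ?W j" using y by blast
    moreover have "?c l \<in> ?W j" using that by (auto intro: span_base)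
    moreover have "z l = ?c l - y l" using yz[of l] by simp
    ultimately show ?thesis unfolding q_def by (simp add: span_diff span_mul)
  qed
  have ortho: "q i \<bullet> q j = (if i = j then 1 else 0)" for i j
    using q1 qW[OF qc[of i j]] qW[OF qc[of j i]]
    by (cases i j rule: linorder_cases) (auto simp: inner_commute)
  define Q :: "((real, 'k) vec, 'n) vec" where "Q = (\<chi> a j. q j $ a)"
  have colQ: "column j Q = q j" for j by (simp add: Q_def column_def vec_eq_iff)
  define T where "T = transpose Q ** C"
  have T: "T $ i $ j = q i \<bullet> ?c j" for i j by (simp add: T_def gram_entry colQ)
  \<comment> \<open>Least counterexample: once the earlier columns lie in the span, so does
    \<open>y i\<close>, and \<open>z i\<close> is a multiple of \<open>q i\<close>.\<close>
  have cq: "?c j \<in> span (range q)" for j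
  proof (rule ccontr)
    let ?D = "{j. ?c j \<notin> span (range q)}"
    assume "?c j \<notin> span (range q)"
    then have ne: "?D \<noteq> {}" by auto
    define i where "i = Min ?D"
    have i: "?c i \<notin> span (range q)" using Min_in[of ?D] ne unfolding i_def by auto
    have before: "?c l \<in> span (range q)" if "l < i" for l
      using Min_le[of ?D l] that unfolding i_def by (metis (mono_tags, lifting) finite leD mem_Collect_eq)
    then have "?W i \<subseteq> span (range q)" by (intro span_minimal) auto
    then have "y i \<in> span (range q)" using y by blast
    moreover have "z i = norm (z i) *\<^sub>R q i" using z0 by (simp add: q_def)
    then have "z i \<in> span (range q)" by (metis rangeI span_base span_mul)
    ultimately show False using i yz[of i] by (simp add: span_add)
  qed
  have "pos_upper T"
    unfolding pos_upper_def
  proof (intro conjI allI impI)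
    fix i j :: 'k assume "j < i"
    then show "T $ i $ j = 0" unfolding T by (intro qW span_base) auto
  next
    fix i :: 'k
    have "q i \<bullet> ?c i = q i \<bullet> z i" using yz[of i] qW[OF y[of i]] by (simp add: inner_add_right)
    also have "\<dots> = norm (z i)" using z0[of i]
      by (simp add: q_def power2_norm_eq_inner[symmetric] power2_eq_square)
    finally show "T $ i $ i > 0" using z0[of i] by (simp add: T)
  qed
  moreover have "C = Q ** T"
  proof -
    have "C $ a $ j = (Q ** T) $ a $ j" for a j
    proof -
      have "C $ a $ j = ?c j $ a" by (simp add: column_def)
      also have "\<dots> = (\<Sum>i\<in>UNIV. (q i \<bullet> ?c j) *\<^sub>R q i) $ a"
        using orthonormal_span_expand[OF ortho cq] by metis
      also have "\<dots> = (Q ** T) $ a $ j"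
        by (simp add: matrix_matrix_mult_def T Q_def mult.commute)
      finally show ?thesis .
    qed
    then show ?thesis by (simp add: vec_eq_iff)
  qed
  moreover have "Q \<in> stiefel" by (simp add: stiefel_columns colQ ortho)
  ultimately show ?thesis using that by blast
qed

text \<open>Uniqueness of the factorization evaluates the definite description in \<open>qf\<close>,
  so that any QR factorization at hand may be used.\<close>

lemma qf_eqI:
  assumes "Q \<in> stiefel" "pos_upper T" "C = Q ** T"
  shows "qf C = Q"
  unfolding qf_def
proof (rule the_equality)
  show "transpose Q ** Q = mat 1 \<and> (\<exists>T. C = Q ** T \<and> (\<forall>i j. j < i \<longrightarrow> T $ i $ j = 0) \<and> (\<forall>i. T $ i $ i > 0))"
    using assms by (auto simp: stiefel_def pos_upper_def)
next
  fix P assume "transpose P ** P = mat 1 \<and> (\<exists>T. C = P ** T \<and> (\<forall>i j. j < i \<longrightarrow> T $ i $ j = 0) \<and> (\<forall>i. T $ i $ i > 0))"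
  then obtain T' where "P \<in> stiefel" "pos_upper T'" "C = P ** T'"
    by (auto simp: stiefel_def pos_upper_def)
  then show "P = Q" using QR_unique assms by metis
qed

section \<open>The QR retraction to second order\<close>

text \<open>Twice the inner product of \<open>U *v v\<close> and \<open>Y *v v\<close> is the
  quadratic form of \<open>transpose Y ** U + transpose U ** Y\<close>, which is zero; so adding
  \<open>Y *v v\<close> cannot shorten \<open>U *v v\<close>. In particular \<open>U + Y\<close> has
  independent columns for tangent vectors of any size.\<close>

lemma tangent_expanding:
  assumes "U \<in> stiefel" "Y \<in> stiefel_tangent (U :: real^'k^'n)"
  shows "norm v \<le> norm ((U + Y) *v v)"
proof -
  have "2 * ((U *v v) \<bullet> (Y *v v)) = (U *v v) \<bullet> (Y *v v) + (Y *v v) \<bullet> (U *v v)"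
    by (simp add: inner_commute)
  also have "\<dots> = ((transpose Y ** U + transpose U ** Y) *v v) \<bullet> v"
    by (simp only: gram_quadratic matrix_vector_mult_add_rdistrib inner_add_left)
  also have "transpose Y ** U + transpose U ** Y = 0"
    using assms(2) by (simp add: stiefel_tangent_def add.commute)
  finally have orth: "(U *v v) \<bullet> (Y *v v) = 0" by simp
  have "(norm v)\<^sup>2 = (norm (U *v v))\<^sup>2" using stiefel_norm_mult[OF assms(1)] by simp
  also have "\<dots> \<le> (norm ((U + Y) *v v))\<^sup>2"
    using orth by (simp add: matrix_vector_mult_add_rdistrib power2_norm_eq_inner inner_add inner_commute)
  finally show ?thesis by (simp add: abs_le_square_iff[symmetric])
qed

lemma norm_column_le: "norm (column i A) \<le> norm (A :: real^'k^'n)"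
  unfolding norm_vec_def[where 'b = 'n]
  by (intro L2_set_mono) (auto simp: column_def component_le_norm_cart)

lemma column_add: "column i (A + B) = column i A + column i (B :: real^'k^'n)"
  by (simp add: column_def vec_eq_iff)

text \<open>The terms linear in \<open>Y\<close> cancel by the tangency equation, so the deviation
  from the identity is quadratic.\<close>

lemma tangent_gram:
  assumes "U \<in> stiefel" "Y \<in> stiefel_tangent (U :: real^'k^'n)"
  shows "(transpose (U + Y) ** (U + Y)) $ i $ j = (if i = j then 1 else 0) + column i Y \<bullet> column j Y"
proof -
  have "(transpose U ** Y + transpose Y ** U) $ i $ j = 0"
    using assms(2) by (simp add: stiefel_tangent_def)
  then have "column i U \<bullet> column j Y + column i Y \<bullet> column j U = 0" by (simp add: gram_entry)
  moreover have "column i U \<bullet> column j U = (if i = j then 1 else 0)"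
    using assms(1) by (simp add: stiefel_columns)
  ultimately show ?thesis by (simp add: gram_entry column_add inner_add)
qed

lemma stiefel_entry_le:
  assumes "Q \<in> stiefel" shows "\<bar>Q $ a $ i\<bar> \<le> (1::real)"
proof -
  have "norm (column i Q) = 1" using assms by (simp add: stiefel_columns norm_eq_1)
  then show ?thesis using component_le_norm_cart[of "column i Q" a] by (simp add: column_def)
qed

lemma norm_matrix_le_sum: "norm A \<le> (\<Sum>a\<in>UNIV. \<Sum>i\<in>UNIV. \<bar>(A :: real^'k^'n) $ a $ i\<bar>)"
proof -
  have "norm A \<le> (\<Sum>a\<in>UNIV. norm (A $ a))" unfolding norm_vec_def by (simp add: L2_set_le_sum)
  also have "\<dots> \<le> (\<Sum>a\<in>UNIV. \<Sum>i\<in>UNIV. \<bar>A $ a $ i\<bar>)" by (intro sum_mono norm_le_l1_cart)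
  finally show ?thesis .
qed

text \<open>Column norms squeeze the diagonal between 1 and 1 + \<epsilon>. Above it,
  \<open>T $ i $ i * T $ i $ j\<close> is a Gram entry minus at most \<open>CARD('k)\<close>
  products, each of size at most \<epsilon>; hence the factor \<open>CARD('k) + 1\<close>. Dividing
  by \<open>T $ i $ i\<close>, which is at least 1, does not enlarge the bound.\<close>

lemma upper_factor_near_id:
  fixes T :: "((real, 'k::{finite,linorder}) vec, 'k) vec"
  assumes T: "pos_upper T" and ge1: "\<And>i. 1 \<le> T $ i $ i"
    and gram: "\<And>i j. \<bar>(transpose T ** T) $ i $ j - (if i = j then 1 else 0)\<bar> \<le> \<epsilon>"
  shows "\<bar>T $ i $ j - (if i = j then 1 else 0)\<bar> \<le> (real CARD('k) + 1) * \<epsilon>"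
proof -
  have "0 \<le> \<epsilon>" using gram[of i i] by linarith
  have col: "(\<Sum>l\<in>UNIV. (T $ l $ j)\<^sup>2) \<le> 1 + \<epsilon>" for j
    using gram[of j j] by (simp add: gram_entry_sum power2_eq_square)
  have sq1: "1 \<le> (T $ j $ j)\<^sup>2" for j using ge1[of j] by (simp add: one_le_power)
  have diag: "T $ j $ j - 1 \<le> \<epsilon>" for j
  proof -
    have "T $ j $ j * 1 \<le> T $ j $ j * T $ j $ j" using ge1[of j] by (intro mult_left_mono) auto
    moreover have "(T $ j $ j)\<^sup>2 \<le> (\<Sum>l\<in>UNIV. (T $ l $ j)\<^sup>2)" by (intro member_le_sum) auto
    ultimately show ?thesis using col[of j] by (simp add: power2_eq_square)
  qed
  \<comment> \<open>This crude bound only enters through products of two off-diagonal entries, which are then \<open>O(\<epsilon>)\<close>.\<close>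
  have off: "\<bar>T $ l $ j\<bar> \<le> sqrt \<epsilon>" if "l \<noteq> j" for l j
  proof -
    have "(\<Sum>i\<in>{l, j}. (T $ i $ j)\<^sup>2) \<le> (\<Sum>i\<in>UNIV. (T $ i $ j)\<^sup>2)" by (intro sum_mono2) auto
    then have "(T $ l $ j)\<^sup>2 \<le> \<epsilon>" using that col[of j] sq1[of j] by simp
    then show ?thesis by (simp add: real_le_rsqrt)
  qed
  show ?thesis
  proof (cases i j rule: linorder_cases)
    case less
    have prod: "\<bar>T $ l $ i * T $ l $ j\<bar> \<le> \<epsilon>" if "l < i" for l
    proof -
      have "\<bar>T $ l $ i\<bar> * \<bar>T $ l $ j\<bar> \<le> sqrt \<epsilon> * sqrt \<epsilon>"
        using that less \<open>0 \<le> \<epsilon>\<close> by (intro mult_mono off) auto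
      then show ?thesis using \<open>0 \<le> \<epsilon>\<close> by (simp add: abs_mult)
    qed
    have "\<bar>\<Sum>l\<in>{l. l < i}. T $ l $ i * T $ l $ j\<bar> \<le> (\<Sum>l\<in>{l. l < i}. \<epsilon>)"
      using prod by (intro order_trans[OF sum_abs] sum_mono) auto
    also have "\<dots> \<le> real CARD('k) * \<epsilon>"
      using \<open>0 \<le> \<epsilon>\<close> by (simp add: mult_right_mono card_mono)
    finally have "\<bar>T $ i $ i * T $ i $ j\<bar> \<le> (real CARD('k) + 1) * \<epsilon>"
      using gram[of i j] less_imp_neq[OF less] unfolding upper_gram_entry[OF T] distrib_right
      by (simp only: if_False mult_1_left)
    moreover have "1 * \<bar>T $ i $ j\<bar> \<le> T $ i $ i * \<bar>T $ i $ j\<bar>"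
      using ge1[of i] by (intro mult_right_mono) auto
    ultimately show ?thesis using less_imp_neq[OF less] ge1[of i] by (simp add: abs_mult)
  next
    case equal
    have "1 * \<epsilon> \<le> (real CARD('k) + 1) * \<epsilon>" using \<open>0 \<le> \<epsilon>\<close> by (intro mult_right_mono) auto
    then show ?thesis using equal diag[of j] ge1[of j] by simp
  next
    case greater
    then show ?thesis using less_imp_neq[OF greater] T \<open>0 \<le> \<epsilon>\<close> by (simp add: pos_upper_def)
  qed
qed

text \<open>With \<open>U + Y = Q ** T\<close> the error is \<open>Q ** (mat 1 - T)\<close>, where
  \<open>Q\<close> has entries of size at most 1 and \<open>T\<close> differs from the identity by a
  term quadratic in \<open>Y\<close>. One constant serves all base points, as needed along moving
  iterates.\<close>

lemma qf_second_order:
  obtains c where "0 \<le> c"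
    and "\<And>U Y. \<lbrakk>U \<in> stiefel; Y \<in> stiefel_tangent U\<rbrakk> \<Longrightarrow>
      norm (qf (U + Y) - (U + (Y :: ((real, 'k::{finite,linorder}) vec, 'n::finite) vec))) \<le> c * (norm Y)\<^sup>2"
proof
  let ?k = "real CARD('k)"
  \<comment> \<open>There are \<open>CARD('n) * CARD('k)\<close> entries, each a sum of
    \<open>CARD('k)\<close> terms of size at most
    \<open>(?k + 1) * (norm Y)\<^sup>2\<close>.\<close>
  let ?c = "real CARD('n) * (?k * (?k * (?k + 1)))"
  show "0 \<le> ?c" by simp
  fix U Y :: "((real, 'k) vec, 'n) vec"
  assume U: "U \<in> stiefel" and Y: "Y \<in> stiefel_tangent U"
  define C where "C = U + Y"
  have expand: "norm v \<le> norm (C *v v)" for v unfolding C_def by (rule tangent_expanding[OF U Y])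
  then have "v = 0" if "C *v v = 0" for v using that by (metis norm_le_zero_iff norm_zero)
  then have "inj ((*v) C)" by (auto simp: linear_injective_0)
  then obtain Q T where QT: "Q \<in> stiefel" "pos_upper T" "C = Q ** T" by (rule QR_exists)
  have "norm v \<le> norm (T *v v)" for v
    using expand[of v] stiefel_norm_mult[OF QT(1), of "T *v v"] by (simp add: QT(3) matrix_vector_mul_assoc)
  then have ge1: "1 \<le> T $ i $ i" for i by (rule pos_upper_diag_ge_1[OF QT(2)])
  have "transpose C ** C = transpose T ** (transpose Q ** Q) ** T"
    by (simp add: QT(3) matrix_transpose_mul matrix_mul_assoc)
  then have "transpose C ** C = transpose T ** T" using QT(1) by (simp add: stiefel_def)
  then have "(transpose T ** T) $ i $ j - (if i = j then 1 else 0) = column i Y \<bullet> column j Y" for i j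
    using tangent_gram[OF U Y, of i j] by (simp add: C_def)
  moreover have "\<bar>column i Y \<bullet> column j Y\<bar> \<le> (norm Y)\<^sup>2" for i j
    using Cauchy_Schwarz_ineq2[of "column i Y" "column j Y"]
      mult_mono[OF norm_column_le[of i Y] norm_column_le[of j Y]] by (simp add: power2_eq_square)
  ultimately have near: "\<bar>T $ i $ j - (if i = j then 1 else 0)\<bar> \<le> (?k + 1) * (norm Y)\<^sup>2" for i j
    using upper_factor_near_id[OF QT(2) ge1, of "(norm Y)\<^sup>2"] by simp
  have entry: "\<bar>(Q - C) $ a $ j\<bar> \<le> ?k * ((?k + 1) * (norm Y)\<^sup>2)" for a j
  proof -
    have "(Q - C) $ a $ j = (Q ** mat 1 - Q ** T) $ a $ j" by (simp add: QT(3))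
    also have "\<dots> = - (\<Sum>l\<in>UNIV. Q $ a $ l * (T $ l $ j - (if l = j then 1 else 0)))"
      by (simp add: matrix_matrix_mult_def mat_def right_diff_distrib sum_subtractf)
    finally have "\<bar>(Q - C) $ a $ j\<bar> \<le> (\<Sum>l\<in>UNIV. \<bar>Q $ a $ l * (T $ l $ j - (if l = j then 1 else 0))\<bar>)"
      by simp
    also have "\<dots> \<le> (\<Sum>l\<in>(UNIV :: 'k set). 1 * ((?k + 1) * (norm Y)\<^sup>2))"
      unfolding abs_mult by (intro sum_mono mult_mono near stiefel_entry_le[OF QT(1)]) auto
    finally show ?thesis by simp
  qed
  have "norm (Q - C) \<le> (\<Sum>a\<in>UNIV. \<Sum>j\<in>UNIV. \<bar>(Q - C) $ a $ j\<bar>)" by (rule norm_matrix_le_sum)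
  also have "\<dots> \<le> (\<Sum>a\<in>(UNIV :: 'n set). \<Sum>j\<in>(UNIV :: 'k set). ?k * ((?k + 1) * (norm Y)\<^sup>2))"
    by (intro sum_mono entry)
  finally show "norm (qf (U + Y) - (U + Y)) \<le> ?c * (norm Y)\<^sup>2"
    using qf_eqI[OF QT] by (simp add: C_def[symmetric] mult_ac)
qed

section \<open>Line search for a second-order retraction\<close>

definition C1_fun :: "('a::euclidean_space \<Rightarrow> real) \<Rightarrow> bool" where
  "C1_fun f \<longleftrightarrow> (\<exists>D. continuous_on UNIV D \<and> (\<forall>p. (f has_derivative (\<lambda>h. D p \<bullet> h)) (at p)))"

lemma C1_funE:
  assumes "C1_fun f"
  obtains D where "continuous_on UNIV D" "\<And>p. (f has_derivative (\<lambda>h. D p \<bullet> h)) (at p)"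
  using assms unfolding C1_fun_def by metis

text \<open>The constant gradient is the adjoint of \<open>f\<close> applied to 1.\<close>

lemma C1_fun_linear:
  assumes "bounded_linear f" shows "C1_fun f"
proof -
  have "linear f" using assms by (rule bounded_linear.linear)
  then have "f = (\<lambda>h. adjoint f 1 \<bullet> h)"
    using adjoint_works[of f _ 1] by (simp add: inner_commute fun_eq_iff)
  then show ?thesis unfolding C1_fun_def
    using bounded_linear_imp_has_derivative[OF assms] by (metis continuous_on_const)
qed

lemma C1_fun_const [intro]: "C1_fun (\<lambda>p. c)"
proof -
  have "((\<lambda>p. c) has_derivative (\<lambda>h. 0 \<bullet> h)) (at p)" for p :: 'a
    by (simp only: inner_zero_left has_derivative_const)
  then show ?thesis unfolding C1_fun_def by (metis continuous_on_const)
qed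

lemma C1_fun_add [intro]:
  assumes "C1_fun f" "C1_fun g" shows "C1_fun (\<lambda>p. f p + g p)"
proof -
  obtain D where D: "continuous_on UNIV D" "\<And>p. (f has_derivative (\<lambda>h. D p \<bullet> h)) (at p)"
    using assms(1) unfolding C1_fun_def by metis
  obtain E where E: "continuous_on UNIV E" "\<And>p. (g has_derivative (\<lambda>h. E p \<bullet> h)) (at p)"
    using assms(2) unfolding C1_fun_def by metis
  show ?thesis unfolding C1_fun_def
  proof (intro exI[of _ "\<lambda>p. D p + E p"] conjI allI)
    show "continuous_on UNIV (\<lambda>p. D p + E p)" using D E by (intro continuous_intros)
    show "((\<lambda>p. f p + g p) has_derivative (\<lambda>h. (D p + E p) \<bullet> h)) (at p)" for p
      unfolding inner_add_left by (intro has_derivative_add D E)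
  qed
qed

lemma C1_fun_mult [intro]:
  assumes "C1_fun f" "C1_fun g" shows "C1_fun (\<lambda>p. f p * g p)"
proof -
  obtain D where D: "continuous_on UNIV D" "\<And>p. (f has_derivative (\<lambda>h. D p \<bullet> h)) (at p)"
    using assms(1) unfolding C1_fun_def by metis
  obtain E where E: "continuous_on UNIV E" "\<And>p. (g has_derivative (\<lambda>h. E p \<bullet> h)) (at p)"
    using assms(2) unfolding C1_fun_def by metis
  have fg: "continuous_on UNIV f" "continuous_on UNIV g"
    using D(2) E(2) by (auto intro!: continuous_at_imp_continuous_on has_derivative_continuous)
  show ?thesis unfolding C1_fun_def
  proof (intro exI[of _ "\<lambda>p. f p *\<^sub>R E p + g p *\<^sub>R D p"] conjI allI)
    show "continuous_on UNIV (\<lambda>p. f p *\<^sub>R E p + g p *\<^sub>R D p)"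
      using D E fg by (intro continuous_intros)
    show "((\<lambda>p. f p * g p) has_derivative (\<lambda>h. (f p *\<^sub>R E p + g p *\<^sub>R D p) \<bullet> h)) (at p)" for p
      using has_derivative_mult[OF D(2)[of p] E(2)[of p]] by (simp add: inner_add_left mult_ac)
  qed
qed

lemma C1_fun_sum [intro]:
  "(\<And>i. i \<in> I \<Longrightarrow> C1_fun (f i)) \<Longrightarrow> C1_fun (\<lambda>p. \<Sum>i\<in>I. f i p)"
  by (induction I rule: infinite_finite_induct) auto

text \<open>This is the one-variable theorem on the segment from \<open>p\<close> to
  \<open>q\<close>. The distance bound forces the intermediate point towards \<open>p\<close> when
  \<open>q - p\<close> shrinks.\<close>

lemma C1_fun_mean_value:
  assumes "\<And>p. (f has_derivative (\<lambda>h. D p \<bullet> h)) (at p)"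
  obtains z where "norm (z - p) \<le> norm (q - p)" "f q - f p = D z \<bullet> (q - p)"
proof -
  let ?l = "\<lambda>t. p + t *\<^sub>R (q - p)"
  have "((\<lambda>t. f (?l t)) has_derivative (\<lambda>h. D (?l t) \<bullet> (h *\<^sub>R (q - p)))) (at t within {0..1})" for t
    by (rule has_derivative_compose[of ?l, OF _ assms]) (auto intro!: derivative_eq_intros)
  then obtain t where t: "t \<in> {0<..<1::real}"
    and eq: "f (?l 1) - f (?l 0) = D (?l t) \<bullet> ((1 - 0) *\<^sub>R (q - p))"
    using mvt_simple[of 0 1 "\<lambda>t. f (?l t)" "\<lambda>t h. D (?l t) \<bullet> (h *\<^sub>R (q - p))"] by auto
  have "norm (?l t - p) \<le> norm (q - p)" using t by (simp add: mult_left_le_one_le)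
  moreover have "f q - f p = D (?l t) \<bullet> (q - p)" using eq by simp
  ultimately show ?thesis by (rule that)
qed

text \<open>The orthogonal projection of \<open>d\<close> onto \<open>T p\<close> represents the
  differential there, and two tangent representatives differ by a tangent vector orthogonal to
  itself. So the definite description denotes this projection.\<close>

lemma riemannian_gradient_represents:
  fixes f :: "'a::euclidean_space \<Rightarrow> real"
  assumes T: "subspace (T p)" and f: "(f has_derivative (\<lambda>h. d \<bullet> h)) (at p)"
  shows "riemannian_gradient T f p \<in> T p"
    and "\<And>\<xi>. \<xi> \<in> T p \<Longrightarrow> riemannian_gradient T f p \<bullet> \<xi> = d \<bullet> \<xi>"
proof -
  have fd: "frechet_derivative f (at p) = (\<lambda>h. d \<bullet> h)" using frechet_derivative_at[OF f] by simp
  obtain y z where "y \<in> span (T p)" "\<And>w. w \<in> span (T p) \<Longrightarrow> orthogonal z w" "d = y + z"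
    using orthogonal_subspace_decomp_exists[of "T p" d] by metis
  then have y: "y \<in> T p \<and> (\<forall>\<xi>\<in>T p. y \<bullet> \<xi> = d \<bullet> \<xi>)"
    using T by (simp add: span_eq_iff[THEN iffD2] inner_add_left orthogonal_def)
  have "riemannian_gradient T f p = y"
    unfolding riemannian_gradient_def fd
  proof (rule the_equality, rule y)
    fix g assume g: "g \<in> T p \<and> (\<forall>\<xi>\<in>T p. g \<bullet> \<xi> = d \<bullet> \<xi>)"
    then have "g - y \<in> T p" using y T by (simp add: subspace_diff)
    then have "(g - y) \<bullet> (g - y) = 0" using g y by (simp add: inner_diff_left)
    then show "g = y" by simp
  qed
  then show "riemannian_gradient T f p \<in> T p"
    and "\<And>\<xi>. \<xi> \<in> T p \<Longrightarrow> riemannian_gradient T f p \<bullet> \<xi> = d \<bullet> \<xi>" using y by auto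
qed

text \<open>This isolates what the convergence argument uses of the manifold.
  \<open>approximate_tangent\<close> is lower semicontinuity of the tangent spaces; it lets a
  vanishing gradient pass to limits without a continuity statement for the Riemannian
  gradient.\<close>

locale second_order_retraction =
  fixes M :: "'a::euclidean_space set" and T :: "'a \<Rightarrow> 'a set" and R :: "'a \<Rightarrow> 'a \<Rightarrow> 'a" and c :: real
  assumes closed_M: "closed M"
    and subspace_T: "p \<in> M \<Longrightarrow> subspace (T p)"
    and approximate_tangent: "\<lbrakk>\<And>n. u n \<in> M; u \<longlonglongrightarrow> q; \<xi> \<in> T q\<rbrakk> \<Longrightarrow>
          \<exists>\<eta>. (\<forall>n. \<eta> n \<in> T (u n)) \<and> \<eta> \<longlonglongrightarrow> \<xi>"
    and second_order: "\<lbrakk>p \<in> M; \<xi> \<in> T p\<rbrakk> \<Longrightarrow> norm (R p \<xi> - (p + \<xi>)) \<le> c * (norm \<xi>)\<^sup>2"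
begin

lemma second_order_abs: "\<lbrakk>p \<in> M; \<xi> \<in> T p\<rbrakk> \<Longrightarrow> norm (R p \<xi> - (p + \<xi>)) \<le> \<bar>c\<bar> * (norm \<xi>)\<^sup>2"
  using second_order by (meson abs_ge_self mult_right_mono order_trans zero_le_power2)

lemma retraction_zero: "p \<in> M \<Longrightarrow> R p 0 = p"
  using second_order[of p 0] subspace_0[OF subspace_T] by simp

text \<open>Along the negative gradient the inner product in the Armijo inequality becomes a squared
  norm. The step is an arbitrary real \<open>s\<close>, so that rejected steps can be treated as a
  sequence tending to zero.\<close>

definition armijo_ok :: "('a \<Rightarrow> real) \<Rightarrow> real \<Rightarrow> 'a \<Rightarrow> real \<Rightarrow> bool" where
  "armijo_ok f \<iota> p s \<longleftrightarrow>
     \<iota> * s * (norm (riemannian_gradient T f p))\<^sup>2 \<le> f p - f (R p (s *\<^sub>R - riemannian_gradient T f p))"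

lemma gradient_represents:
  assumes "p \<in> M" and "(f has_derivative (\<lambda>h. d \<bullet> h)) (at p)"
  shows "riemannian_gradient T f p \<in> T p"
    and "\<And>\<xi>. \<xi> \<in> T p \<Longrightarrow> riemannian_gradient T f p \<bullet> \<xi> = d \<bullet> \<xi>"
  using riemannian_gradient_represents[of T p f d] subspace_T assms by auto

lemma norm_gradient_le:
  assumes "p \<in> M" "(f has_derivative (\<lambda>h. d \<bullet> h)) (at p)"
  shows "norm (riemannian_gradient T f p) \<le> norm d"
proof -
  let ?g = "riemannian_gradient T f p"
  have "norm ?g * norm ?g = d \<bullet> ?g"
    using gradient_represents[OF assms]
    by (metis power2_eq_square power2_norm_eq_inner)
  also have "\<dots> \<le> norm d * norm ?g" by (rule norm_cauchy_schwarz)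
  finally show ?thesis by (metis mult_right_le_imp_le norm_ge_zero order_le_less)
qed

text \<open>If the step \<open>s\<close> fails, the mean value theorem and \<open>R p \<xi> = p + \<xi> + O(|\<xi>|\<^sup>2)\<close> bound
  \<open>(1 - \<iota>)|g|\<^sup>2\<close> by the variation of the ambient gradient near \<open>p\<close> plus \<open>O(s)\<close>.\<close>

lemma armijo_failure_tendsto:
  assumes f: "C1_fun f" and "\<iota> < 1"
    and M: "\<And>n. p n \<in> M" and lim: "p \<longlonglongrightarrow> q"
    and s: "\<And>n. 0 < s n" "s \<longlonglongrightarrow> 0"
    and fail: "\<And>n. \<not> armijo_ok f \<iota> (p n) (s n)"
  shows "(\<lambda>n. riemannian_gradient T f (p n)) \<longlonglongrightarrow> 0"
proof -
  obtain D where contD: "continuous_on UNIV D" and D: "\<And>p. (f has_derivative (\<lambda>h. D p \<bullet> h)) (at p)"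
    using f unfolding C1_fun_def by metis
  have D_lim: "(\<lambda>n. D (u n)) \<longlonglongrightarrow> D v" if "u \<longlonglongrightarrow> v" for u v
    using that contD by (auto intro: continuous_on_tendsto_compose)
  define g where "g n = riemannian_gradient T f (p n)" for n
  have gT: "g n \<in> T (p n)" and gD: "g n \<bullet> g n = D (p n) \<bullet> g n" for n
    using gradient_represents[OF M D] unfolding g_def by auto
  have "Bseq (\<lambda>n. D (p n))" using D_lim[OF lim] by (auto intro: convergent_imp_Bseq convergentI)
  then obtain B where "0 < B" "\<And>n. norm (D (p n)) \<le> B" by (metis BseqE)
  then have gB: "norm (g n) \<le> B" for n
    using norm_gradient_le[OF M D] unfolding g_def by (meson order_trans)
  define r where "r n = R (p n) (s n *\<^sub>R - g n)" for n
  \<comment> \<open>The deviation of the retracted point from the straight step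
    \<open>p n - s n *\<^sub>R g n\<close>.\<close>
  define e where "e n = r n - p n + s n *\<^sub>R g n" for n
  have eB: "norm (e n) \<le> \<bar>c\<bar> * B\<^sup>2 * (s n)\<^sup>2" for n
  proof -
    have "s n *\<^sub>R - g n \<in> T (p n)"
      using gT subspace_T[OF M] by (metis subspace_neg subspace_scale)
    from second_order_abs[OF M this] have "norm (e n) \<le> \<bar>c\<bar> * ((norm (g n))\<^sup>2 * (s n)\<^sup>2)"
      by (simp add: e_def r_def algebra_simps power_mult_distrib)
    also have "\<dots> \<le> \<bar>c\<bar> * (B\<^sup>2 * (s n)\<^sup>2)"
      using gB by (intro mult_left_mono mult_right_mono power_mono) auto
    finally show ?thesis by simp
  qed
  have rp: "norm (r n - p n) \<le> s n * B + \<bar>c\<bar> * B\<^sup>2 * (s n)\<^sup>2" for n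
  proof -
    have "norm (r n - p n) \<le> norm (e n) + norm (s n *\<^sub>R g n)"
      using norm_triangle_ineq4[of "e n" "s n *\<^sub>R g n"] by (simp add: e_def)
    also have "norm (s n *\<^sub>R g n) \<le> s n * B" using s(1)[of n] gB[of n] by simp
    finally show ?thesis using eB[of n] by linarith
  qed
  have "\<exists>z. norm (z - p n) \<le> norm (r n - p n) \<and> f (r n) - f (p n) = D z \<bullet> (r n - p n)" for n
    using C1_fun_mean_value[OF D] by metis
  then obtain z where zp: "\<And>n. norm (z n - p n) \<le> norm (r n - p n)"
    and z: "\<And>n. f (r n) - f (p n) = D (z n) \<bullet> (r n - p n)" by metis
  have "(\<lambda>n. s n * B + \<bar>c\<bar> * B\<^sup>2 * (s n)\<^sup>2) \<longlonglongrightarrow> 0 * B + \<bar>c\<bar> * B\<^sup>2 * 0\<^sup>2"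
    by (intro tendsto_intros s)
  then have small: "(\<lambda>n. s n * B + \<bar>c\<bar> * B\<^sup>2 * (s n)\<^sup>2) \<longlonglongrightarrow> 0" by simp
  have "(\<lambda>n. z n - p n) \<longlonglongrightarrow> 0"
    by (rule Lim_null_comparison[OF always_eventually small]) (blast intro: order_trans[OF zp rp])
  then have z_lim: "z \<longlonglongrightarrow> q" using tendsto_add[OF lim] by fastforce
  let ?h = "\<lambda>n. norm (D (p n) - D (z n)) * B + norm (D (z n)) * (\<bar>c\<bar> * B\<^sup>2 * s n)"
  have main: "(1 - \<iota>) * (norm (g n))\<^sup>2 \<le> ?h n" for n
  proof -
    have "f (p n) - f (r n) < \<iota> * s n * (norm (g n))\<^sup>2"
      using fail[of n] by (simp add: armijo_ok_def g_def r_def not_le)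
    moreover have "f (p n) - f (r n) = s n * (D (z n) \<bullet> g n) - D (z n) \<bullet> e n"
      using z[of n] by (simp add: e_def inner_add_right inner_diff_right)
    \<comment> \<open>One factor \<open>s n\<close> of the quadratic error is split off, so that an
      error of order \<open>s n\<close> remains after cancelling.\<close>
    moreover have "D (z n) \<bullet> e n \<le> s n * (norm (D (z n)) * (\<bar>c\<bar> * B\<^sup>2 * s n))"
    proof -
      have "D (z n) \<bullet> e n \<le> norm (D (z n)) * norm (e n)" by (rule norm_cauchy_schwarz)
      also have "\<dots> \<le> norm (D (z n)) * (\<bar>c\<bar> * B\<^sup>2 * (s n)\<^sup>2)" by (intro mult_left_mono eB) auto
      finally show ?thesis by (simp add: power2_eq_square mult_ac)
    qed
    ultimately have "s n * (D (z n) \<bullet> g n) \<le> s n * (\<iota> * (norm (g n))\<^sup>2 + norm (D (z n)) * (\<bar>c\<bar> * B\<^sup>2 * s n))"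
      by (simp add: algebra_simps)
    then have "D (z n) \<bullet> g n \<le> \<iota> * (norm (g n))\<^sup>2 + norm (D (z n)) * (\<bar>c\<bar> * B\<^sup>2 * s n)"
      using s(1)[of n] by simp
    moreover have "(norm (g n))\<^sup>2 = D (z n) \<bullet> g n + (D (p n) - D (z n)) \<bullet> g n"
      using gD[of n] by (simp add: power2_norm_eq_inner inner_diff_left)
    moreover have "(D (p n) - D (z n)) \<bullet> g n \<le> norm (D (p n) - D (z n)) * B"
      by (rule order_trans[OF norm_cauchy_schwarz mult_left_mono[OF gB]]) simp
    ultimately show ?thesis by (simp add: algebra_simps)
  qed
  have "?h \<longlonglongrightarrow> norm (D q - D q) * B + norm (D q) * (\<bar>c\<bar> * B\<^sup>2 * 0)"
    by (intro tendsto_intros D_lim lim z_lim s)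
  then have "?h \<longlonglongrightarrow> 0" by simp
  then have "(\<lambda>n. (1 - \<iota>) * (norm (g n))\<^sup>2) \<longlonglongrightarrow> 0"
  proof (rule Lim_null_comparison[rotated], intro always_eventually allI)
    show "norm ((1 - \<iota>) * (norm (g n))\<^sup>2) \<le> ?h n" for n using main[of n] \<open>\<iota> < 1\<close> by simp
  qed
  then have "(\<lambda>n. (1 - \<iota>) * (norm (g n))\<^sup>2 / (1 - \<iota>)) \<longlonglongrightarrow> 0 / (1 - \<iota>)"
    using \<open>\<iota> < 1\<close> by (intro tendsto_divide tendsto_const) auto
  then have "(\<lambda>n. (norm (g n))\<^sup>2) \<longlonglongrightarrow> 0" using \<open>\<iota> < 1\<close> by simp
  then show ?thesis unfolding g_def[symmetric] by (simp add: tendsto_norm_zero_iff)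
qed

text \<open>Backtracking terminates: otherwise the failing steps tend to zero at the constant point
  \<open>p\<close>, which forces a zero gradient, and then the first step is accepted. The last
  alternative records the rejected step just before the accepted one, to which the failure lemma
  will be applied.\<close>

lemma armijo_step_cases:
  assumes f: "C1_fun f" and "0 < \<alpha>" "0 < \<beta>" "\<beta> < 1" "\<iota> < 1" and p: "p \<in> M"
  obtains N where "armijo_step T R f p (- riemannian_gradient T f p) \<alpha> \<beta> \<iota> = \<beta> ^ N * \<alpha>"
    and "armijo_ok f \<iota> p (\<beta> ^ N * \<alpha>)"
    and "N = 0 \<or> \<not> armijo_ok f \<iota> p (\<beta> ^ (N - 1) * \<alpha>)"
proof -
  let ?g = "riemannian_gradient T f p"
  let ?ok = "\<lambda>N. armijo_ok f \<iota> p (\<beta> ^ N * \<alpha>)"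
  have ok_iff: "f p - f (R p ((\<beta> ^ N * \<alpha>) *\<^sub>R - ?g)) \<ge> - \<iota> * (?g \<bullet> ((\<beta> ^ N * \<alpha>) *\<^sub>R - ?g)) \<longleftrightarrow> ?ok N" for N
    by (simp add: armijo_ok_def power2_norm_eq_inner mult_ac)
  have ex: "\<exists>N. ?ok N"
  proof (rule ccontr)
    assume fail: "\<nexists>N. ?ok N"
    have "(\<lambda>N. \<beta> ^ N * \<alpha>) \<longlonglongrightarrow> 0 * \<alpha>"
      using assms by (intro tendsto_intros LIMSEQ_power_zero) auto
    then have "(\<lambda>N. ?g) \<longlonglongrightarrow> 0"
      using assms fail by (intro armijo_failure_tendsto[where p = "\<lambda>N. p" and \<iota> = \<iota> and s = "\<lambda>N. \<beta> ^ N * \<alpha>"]) auto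
    then have "?g = 0" by (simp add: LIMSEQ_const_iff)
    then have "?ok 0" using retraction_zero[OF p] by (simp add: armijo_ok_def)
    then show False using fail by blast
  qed
  let ?N = "LEAST N. ?ok N"
  have "armijo_step T R f p (- ?g) \<alpha> \<beta> \<iota> = \<beta> ^ ?N * \<alpha>" by (simp only: armijo_step_def ok_iff)
  moreover have "?ok ?N" using ex by (rule LeastI_ex)
  moreover have "?N = 0 \<or> \<not> ?ok (?N - 1)" using not_less_Least[of "?N - 1" ?ok] by force
  ultimately show ?thesis by (rule that)
qed

text \<open>The gradient at \<open>q\<close> is approximated by tangent vectors
  \<open>\<eta> n\<close> at \<open>p n\<close>. Their products with the ambient gradients tend to
  the squared norm of the gradient at \<open>q\<close>, but equal their products with the Riemannian
  gradients, which tend to zero.\<close>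

lemma gradient_limit_zero:
  assumes f: "C1_fun f" and M: "\<And>n. p n \<in> M" and lim: "p \<longlonglongrightarrow> q"
    and g: "(\<lambda>n. riemannian_gradient T f (p n)) \<longlonglongrightarrow> 0"
  shows "critical_point M T f q"
proof -
  obtain D where contD: "continuous_on UNIV D" and D: "\<And>p. (f has_derivative (\<lambda>h. D p \<bullet> h)) (at p)"
    using f unfolding C1_fun_def by metis
  have q: "q \<in> M" using closed_sequentially[OF closed_M] M lim by blast
  let ?\<xi> = "riemannian_gradient T f q"
  note gq = gradient_represents[OF q D]
  obtain \<eta> where \<eta>: "\<And>n. \<eta> n \<in> T (p n)" "\<eta> \<longlonglongrightarrow> ?\<xi>"
    using approximate_tangent[OF M lim gq(1)] by blast
  have "(\<lambda>n. D (p n) \<bullet> \<eta> n) \<longlonglongrightarrow> D q \<bullet> ?\<xi>"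
    using contD lim \<eta>(2) by (intro tendsto_inner) (auto intro: continuous_on_tendsto_compose)
  moreover have "D (p n) \<bullet> \<eta> n = riemannian_gradient T f (p n) \<bullet> \<eta> n" for n
    using gradient_represents[OF M D] \<eta>(1) by simp
  ultimately have "(\<lambda>n. riemannian_gradient T f (p n) \<bullet> \<eta> n) \<longlonglongrightarrow> D q \<bullet> ?\<xi>" by simp
  moreover have "(\<lambda>n. riemannian_gradient T f (p n) \<bullet> \<eta> n) \<longlonglongrightarrow> 0 \<bullet> ?\<xi>"
    by (intro tendsto_inner g \<eta>)
  ultimately have "D q \<bullet> ?\<xi> = 0" using LIMSEQ_unique by fastforce
  then have "?\<xi> \<bullet> ?\<xi> = 0" using gq by simp
  then show ?thesis using q by (simp add: critical_point_def)
qed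

text \<open>The rule generating the iterates is left open: they stay in \<open>M\<close>, remain
  bounded, and reach a value no larger than the Armijo step would.\<close>

theorem accelerated_line_search_converges:
  fixes p :: "nat \<Rightarrow> 'a"
  assumes f: "C1_fun f" and pos: "0 < \<alpha>" "0 < \<beta>" "\<beta> < 1" "0 < \<iota>" "\<iota> < 1"
    and M: "\<And>t. p t \<in> M" and bdd: "bounded (range p)"
    and decrease: "\<And>t. f (p (Suc t)) \<le> f (R (p t)
       (armijo_step T R f (p t) (- riemannian_gradient T f (p t)) \<alpha> \<beta> \<iota> *\<^sub>R - riemannian_gradient T f (p t)))"
  shows "(\<lambda>t. riemannian_gradient T f (p t)) \<longlonglongrightarrow> 0"
    and "\<exists>r q. strict_mono (r :: nat \<Rightarrow> nat) \<and> critical_point M T f q \<and> (p \<circ> r) \<longlonglongrightarrow> q"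
proof -
  define g where "g t = riemannian_gradient T f (p t)" for t
  define \<tau> where "\<tau> t = armijo_step T R f (p t) (- g t) \<alpha> \<beta> \<iota>" for t
  have "\<exists>N. \<tau> t = \<beta> ^ N * \<alpha> \<and> armijo_ok f \<iota> (p t) (\<beta> ^ N * \<alpha>) \<and>
      (N = 0 \<or> \<not> armijo_ok f \<iota> (p t) (\<beta> ^ (N - 1) * \<alpha>))" for t
    unfolding \<tau>_def g_def using armijo_step_cases[OF f pos(1-3,5) M] by metis
  then obtain N where \<tau>: "\<And>t. \<tau> t = \<beta> ^ N t * \<alpha>" and ok: "\<And>t. armijo_ok f \<iota> (p t) (\<tau> t)"
    and minimal: "\<And>t. N t = 0 \<or> \<not> armijo_ok f \<iota> (p t) (\<beta> ^ (N t - 1) * \<alpha>)" by metis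
  have \<tau>0: "0 < \<tau> t" for t using pos by (simp add: \<tau>)
  have step: "\<iota> * \<tau> t * (norm (g t))\<^sup>2 \<le> f (p t) - f (p (Suc t))" for t
    using ok[of t] decrease[of t] by (simp add: armijo_ok_def g_def[symmetric] \<tau>_def[symmetric])
  have "f (p (Suc t)) \<le> f (p t)" for t
    using step[of t] \<tau>0[of t] pos by (smt (verit) mult_nonneg_nonneg zero_le_power2)
  then have dec: "decseq (\<lambda>t. f (p t))" by (simp add: decseq_Suc_iff)
  obtain D where D: "\<And>p. (f has_derivative (\<lambda>h. D p \<bullet> h)) (at p)" using f by (metis C1_funE)
  \<comment> \<open>\<open>f\<close> is bounded on the compact closure of the iterates, so its
    decreasing values converge and the guaranteed gains tend to zero.\<close>
  have "continuous_on (closure (range p)) f"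
    using D by (auto intro!: continuous_at_imp_continuous_on has_derivative_continuous)
  then have "bounded (f ` closure (range p))"
    using bdd by (intro compact_imp_bounded compact_continuous_image) auto
  then obtain L where "\<And>y. y \<in> f ` closure (range p) \<Longrightarrow> \<bar>y\<bar> \<le> L" by (auto simp: bounded_iff)
  then have "- L \<le> f (p t)" for t using closure_subset[of "range p"] by (smt (verit) image_eqI rangeI subsetD)
  then obtain l where l: "(\<lambda>t. f (p t)) \<longlonglongrightarrow> l" using decseq_convergent[OF dec] by metis
  have "(\<lambda>t. f (p t) - f (p (Suc t))) \<longlonglongrightarrow> l - l" by (intro tendsto_diff l LIMSEQ_Suc)
  then have "(\<lambda>t. f (p t) - f (p (Suc t))) \<longlonglongrightarrow> 0" by simp
  then have "(\<lambda>t. \<iota> * \<tau> t * (norm (g t))\<^sup>2) \<longlonglongrightarrow> 0"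
  proof (rule Lim_null_comparison[rotated], intro always_eventually allI)
    have "0 \<le> \<iota> * \<tau> t * (norm (g t))\<^sup>2" for t using \<tau>0[of t] pos by simp
    then show "norm (\<iota> * \<tau> t * (norm (g t))\<^sup>2) \<le> f (p t) - f (p (Suc t))" for t
      using step[of t] by (simp only: real_norm_def abs_of_nonneg)
  qed
  from tendsto_mult_left[OF this, of "inverse \<iota>"]
  have \<tau>g: "(\<lambda>t. \<tau> t * (norm (g t))\<^sup>2) \<longlonglongrightarrow> 0" using pos by (simp add: field_simps)
  have sub: "\<exists>q r. strict_mono (r :: nat \<Rightarrow> nat) \<and> ((p \<circ> u) \<circ> r) \<longlonglongrightarrow> q" for u :: "nat \<Rightarrow> nat"
    using bounded_imp_convergent_subsequence[of "p \<circ> u"] bounded_subset[OF bdd, of "range (p \<circ> u)"]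
    by (metis image_comp image_mono subset_UNIV)
  show g0: "(\<lambda>t. riemannian_gradient T f (p t)) \<longlonglongrightarrow> 0"
    unfolding g_def[symmetric]
  proof (rule ccontr)
    assume "\<not> g \<longlonglongrightarrow> 0"
    then obtain \<epsilon> where "0 < \<epsilon>" and "frequently (\<lambda>t. \<not> norm (g t) < \<epsilon>) sequentially"
      by (auto simp: tendsto_iff not_eventually)
    then have "infinite {t. \<not> norm (g t) < \<epsilon>}"
      by (simp add: frequently_cofinite[symmetric] cofinite_eq_sequentially)
    then obtain u :: "nat \<Rightarrow> nat" where u: "strict_mono u" "\<And>n. \<epsilon> \<le> norm (g (u n))"
      using infinite_enumerate by (force simp: not_less)
    obtain q r where r: "strict_mono (r :: nat \<Rightarrow> nat)" "((p \<circ> u) \<circ> r) \<longlonglongrightarrow> q" using sub by blast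
    define v where "v = u \<circ> r"
    have v: "strict_mono v" unfolding v_def by (rule strict_mono_o[OF u(1) r(1)])
    have v_lim: "(\<lambda>n. p (v n)) \<longlonglongrightarrow> q" using r(2) by (simp add: v_def o_def)
    have v_ge: "\<epsilon> \<le> norm (g (v n))" for n using u(2) by (simp add: v_def)
    have "(\<lambda>n. \<tau> (v n) * (norm (g (v n)))\<^sup>2 * inverse (\<epsilon>\<^sup>2)) \<longlonglongrightarrow> 0 * inverse (\<epsilon>\<^sup>2)"
      using LIMSEQ_subseq_LIMSEQ[OF \<tau>g v] by (intro tendsto_mult tendsto_const) (simp add: o_def)
    then have bound_lim: "(\<lambda>n. \<tau> (v n) * (norm (g (v n)))\<^sup>2 * inverse (\<epsilon>\<^sup>2)) \<longlonglongrightarrow> 0" by simp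
    \<comment> \<open>Along \<open>v\<close> the gradient norm is at least \<epsilon>, so dividing
      the vanishing gains by the square of \<epsilon> dominates the step sizes.\<close>
    have bound: "norm (\<tau> (v n)) \<le> \<tau> (v n) * (norm (g (v n)))\<^sup>2 * inverse (\<epsilon>\<^sup>2)" for n
    proof -
      have "\<epsilon>\<^sup>2 \<le> (norm (g (v n)))\<^sup>2" using v_ge \<open>0 < \<epsilon>\<close> by (intro power_mono) auto
      then have "\<tau> (v n) * \<epsilon>\<^sup>2 \<le> \<tau> (v n) * (norm (g (v n)))\<^sup>2" using \<tau>0[of "v n"] by simp
      then show ?thesis using \<tau>0[of "v n"] \<open>0 < \<epsilon>\<close> by (simp add: field_simps)
    qed
    have \<tau>v: "(\<lambda>n. \<tau> (v n)) \<longlonglongrightarrow> 0"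
      by (rule Lim_null_comparison[OF _ bound_lim]) (intro always_eventually allI bound)
    then have "eventually (\<lambda>n. \<tau> (v n) < \<alpha>) sequentially" using pos by (intro order_tendstoD)
    then obtain n0 where n0: "\<And>n. n0 \<le> n \<Longrightarrow> \<tau> (v n) < \<alpha>" by (auto simp: eventually_sequentially)
    \<comment> \<open>A step below \<alpha> is not the first trial, so dividing it by \<beta> gives
      the preceding trial, which was rejected. These rejected steps tend to zero as well.\<close>
    have fails: "\<not> armijo_ok f \<iota> (p (v (n + n0))) (\<tau> (v (n + n0)) / \<beta>)" for n
    proof -
      have "N (v (n + n0)) \<noteq> 0" using n0[of "n + n0"] \<tau>[of "v (n + n0)"] by (intro notI) simp
      then obtain k where "N (v (n + n0)) = Suc k" by (metis not0_implies_Suc)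
      then show ?thesis using minimal[of "v (n + n0)"] pos by (simp add: \<tau>)
    qed
    have "(\<lambda>n. g (v (n + n0))) \<longlonglongrightarrow> 0"
      unfolding g_def
    proof (rule armijo_failure_tendsto[OF f pos(5) M _ _ _ fails])
      show "(\<lambda>n. p (v (n + n0))) \<longlonglongrightarrow> q" using v_lim by (rule LIMSEQ_ignore_initial_segment)
      show "0 < \<tau> (v (n + n0)) / \<beta>" for n using \<tau>0 pos by simp
      have "(\<lambda>n. \<tau> (v (n + n0)) / \<beta>) \<longlonglongrightarrow> 0 / \<beta>"
        using LIMSEQ_ignore_initial_segment[OF \<tau>v, of n0] pos by (intro tendsto_divide tendsto_const) auto
      then show "(\<lambda>n. \<tau> (v (n + n0)) / \<beta>) \<longlonglongrightarrow> 0" by simp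
    qed
    then have "eventually (\<lambda>n. norm (g (v (n + n0))) < \<epsilon>) sequentially"
      using \<open>0 < \<epsilon>\<close> by (auto simp: tendsto_iff)
    then show False using v_ge by (auto simp: eventually_sequentially not_less[symmetric])
  qed
  obtain q r where r: "strict_mono (r :: nat \<Rightarrow> nat)" "(p \<circ> r) \<longlonglongrightarrow> q" using sub[of id] by auto
  moreover have "critical_point M T f q"
    using LIMSEQ_subseq_LIMSEQ[OF g0 r(1)] r(2)
    by (intro gradient_limit_zero[OF f, where p = "p \<circ> r"]) (auto simp: o_def M)
  ultimately show "\<exists>r q. strict_mono (r :: nat \<Rightarrow> nat) \<and> critical_point M T f q \<and> (p \<circ> r) \<longlonglongrightarrow> q"
    by blast
qed

end

section \<open>The Stiefel product manifold and the objective\<close>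

lemma tendsto_matrix_mult:
  fixes A :: "'b \<Rightarrow> real^'n^'m" and B :: "'b \<Rightarrow> real^'k^'n"
  assumes "(A \<longlongrightarrow> a) F" "(B \<longlongrightarrow> b) F"
  shows "((\<lambda>t. A t ** B t) \<longlongrightarrow> a ** b) F"
  unfolding matrix_matrix_mult_def
  by (intro vec_tendstoI) (auto intro!: tendsto_intros assms)

lemma tendsto_transpose:
  fixes A :: "'b \<Rightarrow> real^'n^'m"
  assumes "(A \<longlongrightarrow> a) F"
  shows "((\<lambda>t. transpose (A t)) \<longlongrightarrow> transpose a) F"
  unfolding transpose_def by (intro vec_tendstoI) (auto intro!: tendsto_intros assms)

lemma closed_stiefel: "closed (stiefel :: (real^'k^'n) set)"
proof (unfold closed_sequential_limits, intro allI impI, elim conjE)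
  fix X :: "nat \<Rightarrow> real^'k^'n" and l
  assume X: "\<forall>n. X n \<in> stiefel" and l: "X \<longlonglongrightarrow> l"
  have "(\<lambda>n. transpose (X n) ** X n) \<longlonglongrightarrow> transpose l ** l"
    by (intro tendsto_matrix_mult tendsto_transpose l)
  then have "(\<lambda>n. mat 1) \<longlonglongrightarrow> transpose l ** l" using X by (simp add: stiefel_def)
  then show "l \<in> stiefel" by (simp add: stiefel_def LIMSEQ_const_iff)
qed

lemma bounded_stiefel: "bounded (stiefel :: (real^'k^'n) set)"
proof -
  have "norm Q \<le> (\<Sum>a\<in>(UNIV :: 'n set). \<Sum>i\<in>(UNIV :: 'k set). 1)" if "Q \<in> stiefel" for Q :: "real^'k^'n"
    using norm_matrix_le_sum by (rule order_trans) (intro sum_mono stiefel_entry_le that)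
  then show ?thesis by (auto simp: bounded_iff)
qed

section \<open>Tangent spaces of the Stiefel manifold\<close>

lemma stiefel_tangent_columns:
  "Z \<in> stiefel_tangent X \<longleftrightarrow>
     (\<forall>i j. column i X \<bullet> column j Z + column i Z \<bullet> column j (X :: real^'k^'n) = 0)"
  by (simp add: stiefel_tangent_def vec_eq_iff gram_entry)

lemma subspace_stiefel_tangent: "subspace (stiefel_tangent (X :: real^'k^'n))"
proof -
  have col: "column i (c *\<^sub>R Z) = c *\<^sub>R column i Z" "column i 0 = 0" for c i and Z :: "real^'k^'n"
    by (simp_all add: column_def vec_eq_iff)
  show ?thesis
  proof (rule subspaceI)
    show "0 \<in> stiefel_tangent X" by (simp add: stiefel_tangent_columns col)
  next
    fix Y Z assume "Y \<in> stiefel_tangent X" "Z \<in> stiefel_tangent X"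
    then have "(column i X \<bullet> column j Y + column i Y \<bullet> column j X) +
        (column i X \<bullet> column j Z + column i Z \<bullet> column j X) = 0" for i j
      by (simp add: stiefel_tangent_columns)
    then show "Y + Z \<in> stiefel_tangent X"
      by (simp add: stiefel_tangent_columns column_add inner_add add_ac)
  next
    fix c Z assume "Z \<in> stiefel_tangent X"
    then have "c * (column i X \<bullet> column j Z + column i Z \<bullet> column j X) = 0" for i j
      by (simp add: stiefel_tangent_columns)
    then show "c *\<^sub>R Z \<in> stiefel_tangent X"
      by (simp add: stiefel_tangent_columns col distrib_left)
  qed
qed

text \<open>For \<open>X\<close> on the Stiefel manifold this is the orthogonal projection onto the
  tangent space. What matters here is that it lands in that space, fixes tangent vectors and is
  continuous in \<open>X\<close>.\<close>

definition tangent_proj :: "real^'k^'n \<Rightarrow> real^'k^'n \<Rightarrow> real^'k^'n" where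
  "tangent_proj X Z = Z - X ** ((1/2) *\<^sub>R (transpose X ** Z + transpose Z ** X))"

text \<open>By \<open>transpose X ** X = mat 1\<close> and symmetry of \<open>S\<close>, the
  correction \<open>X ** S\<close> contributes \<open>S\<close> to each half of the tangency
  equation, and \<open>S + S\<close> is exactly its defect at \<open>Z\<close>.\<close>

lemma tangent_proj_in:
  assumes "X \<in> stiefel" shows "tangent_proj X Z \<in> stiefel_tangent X"
proof -
  define S where "S = (1/2) *\<^sub>R (transpose X ** Z + transpose Z ** X)"
  have gram: "transpose X ** X = mat 1" using assms by (simp add: stiefel_def)
  have tdiff: "transpose (A - B) = transpose A - transpose B" for A B :: "real^'k^'n"
    by (simp add: transpose_def vec_eq_iff)
  have "transpose S = S"
    by (simp add: S_def vec_eq_iff transpose_def matrix_matrix_mult_def mult.commute add.commute)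
  moreover have "transpose X ** (Z - X ** S) = transpose X ** Z - transpose X ** (X ** S)"
    and "(transpose Z - transpose S ** transpose X) ** X = transpose Z ** X - transpose S ** transpose X ** X"
    by (simp_all add: matrix_matrix_mult_def vec_eq_iff algebra_simps sum_subtractf)
  moreover have "transpose X ** (X ** S) = S" "transpose S ** transpose X ** X = transpose S"
    by (simp_all add: matrix_mul_assoc gram) (simp add: gram flip: matrix_mul_assoc)
  ultimately have "transpose X ** (Z - X ** S) + transpose (Z - X ** S) ** X =
      transpose X ** Z + transpose Z ** X - (S + S)"
    by (simp add: tdiff matrix_transpose_mul)
  also have "S + S = transpose X ** Z + transpose Z ** X"
    by (simp add: S_def flip: scaleR_add_left)
  finally show ?thesis by (simp add: stiefel_tangent_def tangent_proj_def S_def)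
qed

lemma tangent_proj_id: "Z \<in> stiefel_tangent X \<Longrightarrow> tangent_proj X Z = Z"
  by (simp add: stiefel_tangent_def tangent_proj_def)

lemma tendsto_tangent_proj:
  assumes "(X \<longlongrightarrow> a) F" "Z \<in> stiefel_tangent a"
  shows "((\<lambda>t. tangent_proj (X t) Z) \<longlongrightarrow> Z) F"
proof -
  have "((\<lambda>t. tangent_proj (X t) Z) \<longlongrightarrow> tangent_proj a Z) F"
    unfolding tangent_proj_def
    by (intro tendsto_diff tendsto_const tendsto_matrix_mult tendsto_scaleR tendsto_add tendsto_transpose assms)
  then show ?thesis using tangent_proj_id[OF assms(2)] by simp
qed

text \<open>The vector component is retracted by plain addition, so errors arise only in the two
  Stiefel components and their constants add up. Approximating tangent vectors come from projecting
  these components of the limit vector at each \<open>u n\<close>.\<close>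

lemma svd_retraction:
  obtains c where "second_order_retraction svd_manifold svd_tangent
    (qf_retraction :: ('m::finite, 'k::{finite,linorder}, 'n::finite) triple \<Rightarrow> _) c"
proof -
  obtain c where c: "0 \<le> c"
    "\<And>U Y :: ((real, 'k) vec, 'm) vec. \<lbrakk>U \<in> stiefel; Y \<in> stiefel_tangent U\<rbrakk> \<Longrightarrow> norm (qf (U + Y) - (U + Y)) \<le> c * (norm Y)\<^sup>2"
    using qf_second_order by blast
  obtain d where d: "0 \<le> d"
    "\<And>U Y :: ((real, 'k) vec, 'n) vec. \<lbrakk>U \<in> stiefel; Y \<in> stiefel_tangent U\<rbrakk> \<Longrightarrow> norm (qf (U + Y) - (U + Y)) \<le> d * (norm Y)\<^sup>2"
    using qf_second_order by blast
  have "second_order_retraction svd_manifold svd_tangent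
    (qf_retraction :: ('m, 'k, 'n) triple \<Rightarrow> _) (c + d)"
  proof
    show "closed (svd_manifold :: ('m, 'k, 'n) triple set)"
      unfolding svd_manifold_def by (intro closed_Times closed_stiefel closed_UNIV)
  next
    fix p :: "('m, 'k, 'n) triple"
    show "subspace (svd_tangent p)"
      by (cases p) (simp add: svd_tangent_def subspace_Times subspace_stiefel_tangent)
  next
    fix u :: "nat \<Rightarrow> ('m, 'k, 'n) triple" and q \<xi> :: "('m, 'k, 'n) triple"
    assume u: "\<And>n. u n \<in> svd_manifold" and lim: "u \<longlonglongrightarrow> q" and \<xi>: "\<xi> \<in> svd_tangent q"
    obtain A a B where q: "q = (A, a, B)" by (cases q)
    obtain Y y Z where \<xi>_eq: "\<xi> = (Y, y, Z)" by (cases \<xi>)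
    have YZ: "Y \<in> stiefel_tangent A" "Z \<in> stiefel_tangent B"
      using \<xi> by (auto simp: q \<xi>_eq svd_tangent_def)
    have lims: "(\<lambda>n. fst (u n)) \<longlonglongrightarrow> A" "(\<lambda>n. snd (snd (u n))) \<longlonglongrightarrow> B"
      using tendsto_fst[OF lim] tendsto_snd[OF tendsto_snd[OF lim]] by (simp_all add: q)
    let ?\<eta> = "\<lambda>n. (tangent_proj (fst (u n)) Y, y, tangent_proj (snd (snd (u n))) Z)"
    have "?\<eta> n \<in> svd_tangent (u n)" for n
      using u[of n] by (cases "u n") (auto simp: svd_manifold_def svd_tangent_def tangent_proj_in)
    moreover have "?\<eta> \<longlonglongrightarrow> \<xi>"
      unfolding \<xi>_eq by (intro tendsto_Pair tendsto_const tendsto_tangent_proj[OF lims(1) YZ(1)] tendsto_tangent_proj[OF lims(2) YZ(2)])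
    ultimately show "\<exists>\<eta>. (\<forall>n. \<eta> n \<in> svd_tangent (u n)) \<and> \<eta> \<longlonglongrightarrow> \<xi>"
      by (intro exI[of _ ?\<eta>]) auto
  next
    fix p \<xi> :: "('m, 'k, 'n) triple"
    assume p: "p \<in> svd_manifold" and \<xi>: "\<xi> \<in> svd_tangent p"
    obtain U x V where p_eq: "p = (U, x, V)" by (cases p)
    obtain Y y Z where \<xi>_eq: "\<xi> = (Y, y, Z)" by (cases \<xi>)
    have "norm (qf_retraction p \<xi> - (p + \<xi>)) = norm (qf (U + Y) - (U + Y), 0 :: (real, 'k) vec, qf (V + Z) - (V + Z))"
      by (simp add: p_eq \<xi>_eq qf_retraction_def)
    also have "\<dots> \<le> norm (qf (U + Y) - (U + Y)) + norm (qf (V + Z) - (V + Z))"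
      using norm_Pair_le[of "qf (U + Y) - (U + Y)" "(0 :: (real, 'k) vec, qf (V + Z) - (V + Z))"]
      by simp
    also have "\<dots> \<le> c * (norm Y)\<^sup>2 + d * (norm Z)\<^sup>2"
      using p \<xi> by (intro add_mono c d) (auto simp: p_eq \<xi>_eq svd_manifold_def svd_tangent_def)
    also have "\<dots> \<le> c * (norm \<xi>)\<^sup>2 + d * (norm \<xi>)\<^sup>2"
      using norm_fst_le[of Y "(y, Z)"] order_trans[OF norm_snd_le[of Z y] norm_snd_le[of "(y, Z)" Y]]
      by (intro add_mono mult_left_mono power_mono c(1) d(1)) (auto simp: \<xi>_eq)
    finally show "norm (qf_retraction p \<xi> - (p + \<xi>)) \<le> (c + d) * (norm \<xi>)\<^sup>2"
      by (simp add: distrib_right)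
  qed
  then show ?thesis by (rule that)
qed

text \<open>In coordinates the objective is a polynomial. Subtraction is written as adding
  \<open>(- 1)\<close> times a term, so that closure under sums and products suffices and the
  gradient is never computed.\<close>

lemma C1_fun_objective: "C1_fun (objective W A lam :: ('m::finite, 'k::finite, 'n::finite) triple \<Rightarrow> real)"
proof -
  have entry: "(U ** diag_matrix x ** transpose V) $ i $ j = (\<Sum>l\<in>UNIV. U $ i $ l * x $ l * V $ j $ l)"
    for U :: "((real, 'k) vec, 'm) vec" and x and V :: "((real, 'k) vec, 'n) vec" and i j
    by (simp add: matrix_matrix_mult_def diag_matrix_def transpose_def if_distrib cong: if_cong)
  have "objective W A lam = (\<lambda>p :: ('m, 'k, 'n) triple.
      (\<Sum>i\<in>UNIV. \<Sum>j\<in>UNIV. W $ i $ j *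
         ((A $ i $ j + (- 1) * (\<Sum>l\<in>UNIV. fst p $ i $ l * fst (snd p) $ l * snd (snd p) $ j $ l)) *
          (A $ i $ j + (- 1) * (\<Sum>l\<in>UNIV. fst p $ i $ l * fst (snd p) $ l * snd (snd p) $ j $ l)))) +
      lam * (\<Sum>l\<in>UNIV. fst (snd p) $ l * fst (snd p) $ l))"
    by (simp add: fun_eq_iff objective_def entry power2_eq_square[symmetric] power2_norm_eq_inner inner_vec_def)
  moreover have "C1_fun (\<lambda>p :: ('m, 'k, 'n) triple. fst p $ i $ l)" for i l
    by (intro C1_fun_linear bounded_linear_vec_nth[THEN bounded_linear_compose] bounded_linear_fst)
  moreover have "C1_fun (\<lambda>p :: ('m, 'k, 'n) triple. fst (snd p) $ l)" for l
    by (intro C1_fun_linear bounded_linear_vec_nth[THEN bounded_linear_compose] bounded_linear_fst_comp bounded_linear_snd)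
  moreover have "C1_fun (\<lambda>p :: ('m, 'k, 'n) triple. snd (snd p) $ j $ l)" for j l
    by (intro C1_fun_linear bounded_linear_vec_nth[THEN bounded_linear_compose] bounded_linear_snd_comp bounded_linear_snd)
  ultimately show ?thesis by (simp only:) (intro C1_fun_add C1_fun_sum C1_fun_mult C1_fun_const)
qed

text \<open>The weighted squares are nonnegative. This controls the vector component, the only
  unbounded factor of the manifold.\<close>

lemma objective_ge:
  assumes "\<And>i j. W $ i $ j \<ge> 0"
  shows "lam * (norm x)\<^sup>2 \<le> objective W A lam (U, x, V)"
  unfolding objective_def Let_def by (simp add: assms sum_nonneg)

theorem propositionC9:
  fixes A W :: "real^'n^'m"
    and lam \<alpha> \<beta> \<iota> :: real
    and U0 :: "real^('k::{finite,linorder})^'m" and x0 :: "real^('k::{finite,linorder})" and V0 :: "real^('k::{finite,linorder})^'n"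
    and U :: "nat \<Rightarrow> real^('k::{finite,linorder})^'m" and x :: "nat \<Rightarrow> real^('k::{finite,linorder})" and V :: "nat \<Rightarrow> real^('k::{finite,linorder})^'n"
  defines "G \<equiv> objective W A lam"
  defines "grad \<equiv> riemannian_gradient svd_tangent G"
  defines "\<tau> \<equiv> \<lambda>t. armijo_step svd_tangent qf_retraction G (U t, x t, V t)
                     (- grad (U t, x t, V t)) \<alpha> \<beta> \<iota>"
  assumes "CARD('k) \<le> min CARD('m) CARD('n)"
    and "\<And>i j. W $ i $ j \<ge> 0"
    and "(\<Sum>i\<in>UNIV. \<Sum>j\<in>UNIV. W $ i $ j) = 1"
    and "lam > 0"
    and "\<alpha> > 0"
    and "0 < \<beta>" "\<beta> < 1"
    and "0 < \<iota>" "\<iota> < 1"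
    and "(U0, x0, V0) \<in> svd_manifold"
    and "(U 0, x 0, V 0) = (U0, x0, V0)"
    and "\<And>t. (U t, x t, V t) \<in> svd_manifold"
    and "\<And>t. G (U t, x t, V t) - G (U (Suc t), x (Suc t), V (Suc t))
             \<ge> G (U t, x t, V t)
                - G (qf_retraction (U t, x t, V t) (- \<tau> t *\<^sub>R grad (U t, x t, V t)))"
  shows "(\<lambda>t. norm (grad (U t, x t, V t))) \<longlonglongrightarrow> 0 \<and>
         (\<exists>r p. strict_mono (r :: nat \<Rightarrow> nat) \<and> critical_point svd_manifold svd_tangent G p \<and>
                (\<lambda>t. (U (r t), x (r t), V (r t))) \<longlonglongrightarrow> p)"
proof -
  let ?p = "\<lambda>t. (U t, x t, V t)"
  obtain c where "second_order_retraction svd_manifold svd_tangent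
      (qf_retraction :: ('m, 'k, 'n) triple \<Rightarrow> _) c"
    by (rule svd_retraction)
  then interpret second_order_retraction svd_manifold svd_tangent
    "qf_retraction :: ('m, 'k, 'n) triple \<Rightarrow> _" c .
  have f: "C1_fun G" unfolding G_def by (rule C1_fun_objective)
  note M = assms(15)
  have step: "G (?p (Suc t)) \<le> G (qf_retraction (?p t) (\<tau> t *\<^sub>R - grad (?p t)))" for t
    using assms(16)[of t] by simp
  \<comment> \<open>Descent is derived before the convergence theorem is invoked, because the
    boundedness required there rests on it.\<close>
  have "G (?p (Suc t)) \<le> G (?p t)" for t
  proof -
    obtain N where "\<tau> t = \<beta> ^ N * \<alpha>" "armijo_ok G \<iota> (?p t) (\<tau> t)"
      using armijo_step_cases[OF f assms(8-10,12) M[of t]] unfolding \<tau>_def grad_def by metis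
    moreover from this have "0 \<le> \<iota> * \<tau> t * (norm (grad (?p t)))\<^sup>2" using assms by simp
    ultimately show ?thesis using step[of t] by (simp add: armijo_ok_def grad_def)
  qed
  then have "decseq (\<lambda>t. G (?p t))" by (simp add: decseq_Suc_iff)
  then have "G (?p t) \<le> G (?p 0)" for t by (simp add: decseq_def)
  \<comment> \<open>The regularization term never exceeds the initial value of \<open>G\<close>,
    which confines all \<open>x t\<close> to one ball.\<close>
  then have "lam * (norm (x t))\<^sup>2 \<le> G (?p 0)" for t
    using objective_ge[OF assms(5), of lam "x t" A "U t" "V t"] order_trans unfolding G_def by blast
  then have "norm (x t) \<le> sqrt (G (?p 0) / lam)" for t
    using \<open>lam > 0\<close> by (intro real_le_rsqrt) (simp add: pos_le_divide_eq mult.commute)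
  then have "range ?p \<subseteq> stiefel \<times> cball 0 (sqrt (G (?p 0) / lam)) \<times> stiefel"
    using M by (auto simp: svd_manifold_def)
  then have bdd: "bounded (range ?p)"
    by (rule bounded_subset[rotated]) (intro bounded_Times bounded_stiefel bounded_cball)
  note conv = accelerated_line_search_converges[OF f assms(8-12), where p = ?p, OF M bdd
      step[unfolded \<tau>_def grad_def]]
  show ?thesis
    using tendsto_norm_zero[OF conv(1)] conv(2) by (simp add: grad_def o_def)
qed

end
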